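(* Let $f\in B_0$ be non-constant and $g_1,\ldots,g_n\in\mathrm{GL}_2^+(\mathbb{Q})$. Suppose that the functions $f(g_1z),\ldots,f(g_nz)$ are pairwise distinct. Then $f(g_1z),\ldots,f(g_nz)$ are multiplicatively independent modulo constants.
   Context: $\mathbb{H}$ is the upper half-plane, with $\mathrm{GL}_2^+(\mathbb{Q})$ acting by Möbius transformations. $B_0$ denotes the multiplicative group of modular functions $f$ (meromorphic functions on $\mathbb{H}$ invariant under $\mathrm{SL}_2(\mathbb{Z})$, i.e. weight $0$ meromorphic modular forms for the trivial character) all of whose zeros and poles in $\mathbb{H}$ are at imaginary quadratic numbers, whose Fourier expansion in $q=e^{2\pi i z}$ has integer coefficients, and whose leading Fourier coefficient is $1$. Functions $f_1,\ldots,f_n$ are multiplicatively independent modulo constants if there are no $a_i\in\mathbb{Z}$, not all zero, and $c\in\mathbb{C}$ with $\prod f_i^{a_i}=c$ identically. *)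

theory Defs
  imports "HOL-Complex_Analysis.Complex_Analysis"
begin

definition upper_half_plane :: "complex set" where
  "upper_half_plane = {z. Im z > 0}"

definition GL2_Q_pos :: "(rat^2^2) set" where
  "GL2_Q_pos = {g. det g > 0}"

definition SL2_Z :: "(rat^2^2) set" where
  "SL2_Z = {g. det g = 1 \<and> (\<forall>i j. g $ i $ j \<in> \<int>)}"

definition mat_act :: "rat^2^2 \<Rightarrow> complex \<Rightarrow> complex" where
  "mat_act g = moebius (of_rat (g $ 1 $ 1)) (of_rat (g $ 1 $ 2))
                       (of_rat (g $ 2 $ 1)) (of_rat (g $ 2 $ 2))"

text \<open>
  Equality of meromorphic functions on the upper half-plane: functions on the type of complex
  numbers carry arbitrary values at poles (and outside the half-plane), so we ask for equality
  of values off a set without accumulation points in the half-plane.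
\<close>

definition mero_eq :: "(complex \<Rightarrow> complex) \<Rightarrow> (complex \<Rightarrow> complex) \<Rightarrow> bool" where
  "mero_eq F G \<longleftrightarrow> (\<forall>\<^sub>\<approx>z\<in>upper_half_plane. F z = G z)"

definition imaginary_quadratic :: "complex \<Rightarrow> bool" where
  "imaginary_quadratic z \<longleftrightarrow> z \<notin> \<real> \<and>
     (\<exists>a b c :: int. a \<noteq> 0 \<and> of_int a * z ^ 2 + of_int b * z + of_int c = 0)"

definition has_q_expansion :: "(complex \<Rightarrow> complex) \<Rightarrow> complex fls \<Rightarrow> bool" where
  "has_q_expansion f L \<longleftrightarrow> fls_conv_radius L > 0 \<and>
     (\<exists>y. \<forall>z. Im z > y \<longrightarrow> f z = eval_fls L (exp (2 * of_real pi * \<i> * z)))"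

text \<open>
  The existence of a Fourier expansion with finite principal part expresses meromorphy at the
  cusp. The normalisation \<open>nicely_meromorphic_on\<close> (value 0 at poles, no removable singularities)
  singles out one representative on the half-plane of each meromorphic function, for which
  invariance may be stated pointwise.
\<close>

definition modular_function :: "(complex \<Rightarrow> complex) \<Rightarrow> bool" where
  "modular_function f \<longleftrightarrow>
     f nicely_meromorphic_on upper_half_plane \<and>
     (\<forall>g\<in>SL2_Z. \<forall>z\<in>upper_half_plane. f (mat_act g z) = f z) \<and>
     (\<exists>L. has_q_expansion f L)"

definition B0 :: "(complex \<Rightarrow> complex) set" where
  "B0 = {f. modular_function f \<and>
            (\<forall>z\<in>upper_half_plane. isolated_zero f z \<or> is_pole f z \<longrightarrow> imaginary_quadratic z) \<and>
            (\<exists>L. has_q_expansion f L \<and> (\<forall>k. fls_nth L k \<in> \<int>) \<and>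
                 fls_nth L (fls_subdegree L) = 1)}"

definition mult_indep_mod_const :: "nat \<Rightarrow> (nat \<Rightarrow> complex \<Rightarrow> complex) \<Rightarrow> bool" where
  "mult_indep_mod_const n F \<longleftrightarrow>
     \<not> (\<exists>(a :: nat \<Rightarrow> int) (c :: complex). (\<exists>i\<in>{1..n}. a i \<noteq> 0) \<and>
          mero_eq (\<lambda>z. \<Prod>i\<in>{1..n}. F i z powi a i) (\<lambda>_. c))"

end

theory Submission
  imports Defs
begin

text \<open>
  A nicely meromorphic function vanishes exactly at its zeros and poles, so \<open>Z = {z. f z = 0}\<close> is an
  \<open>SL\<^sub>2(\<int>)\<close>-invariant set of imaginary quadratic points, finite modulo \<open>SL\<^sub>2(\<int>)\<close>. By Hermite
  reduction \<open>f (g\<^sub>i z) = f (\<nu>\<^sub>i z + \<beta>\<^sub>i)\<close> with rational \<open>\<nu>\<^sub>i > 0\<close> and \<open>\<beta>\<^sub>i\<close>. In a multiplicative relation,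
  let \<open>i\<^sub>0\<close> be an index with nonzero exponent and minimal \<open>\<nu>\<close>, and let \<open>s \<in> Z\<close> be a point whose
  discriminant is maximal in absolute value. Replacing \<open>s\<close> by an equivalent point, its primitive form has
  leading coefficient coprime to the finitely many integers occurring in \<open>\<nu>\<^sub>i / \<nu>\<^sub>i\<^sub>0\<close> and
  \<open>\<beta>\<^sub>i - \<beta>\<^sub>i\<^sub>0 \<nu>\<^sub>i / \<nu>\<^sub>i\<^sub>0\<close>. If \<open>g\<^sub>i\<^sub>0 z = s\<close>, then every other \<open>g\<^sub>i z\<close> has a strictly larger
  discriminant, hence lies outside \<open>Z\<close>, and exactly one factor of the product has a zero or pole at \<open>z\<close>.
\<close>

subsection \<open>Discriminants of imaginary quadratic points\<close>

definition primitive_form_root :: "complex \<Rightarrow> int \<Rightarrow> int \<Rightarrow> int \<Rightarrow> bool" where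
  "primitive_form_root z A B C \<longleftrightarrow>
     gcd A (gcd B C) = 1 \<and> of_int A * z\<^sup>2 + of_int B * z + of_int C = 0"

text \<open>The discriminant with its sign reversed, so that it is positive for nonreal
  \<open>z\<close>. The two primitive forms of such a \<open>z\<close> differ by a sign and give the
  same value.\<close>

definition has_neg_disc :: "complex \<Rightarrow> int \<Rightarrow> bool" where
  "has_neg_disc z D \<longleftrightarrow> (\<exists>A B C. primitive_form_root z A B C \<and> D = 4 * A * C - B\<^sup>2)"

lemma int_linear_nonreal_root:
  fixes z :: complex and p q :: int
  assumes "z \<notin> \<real>" "of_int p * z + of_int q = 0"
  shows "p = 0 \<and> q = 0"
proof -
  have "Im z \<noteq> 0" using assms(1) by (simp add: complex_is_Real_iff)
  moreover have "Im (of_int p * z + of_int q) = 0" using assms(2) by simp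
  ultimately have "p = 0" by simp
  with assms(2) show ?thesis by simp
qed

text \<open>Eliminating the square of \<open>z\<close> from the two equations leaves an integral
  linear relation, which is trivial for nonreal \<open>z\<close>. Hence the coefficient triples are
  proportional, and primitivity makes the ratio an integer.\<close>

lemma primitive_form_root_multiple:
  assumes z: "z \<notin> \<real>" and prim: "primitive_form_root z A B C"
    and root: "of_int A' * z\<^sup>2 + of_int B' * z + of_int C' = 0"
  obtains k where "A' = k * A" "B' = k * B" "C' = k * C"
proof -
  have root0: "of_int A * z\<^sup>2 + of_int B * z + of_int C = 0"
    and gcd1: "gcd A (gcd B C) = 1"
    using prim by (auto simp: primitive_form_root_def)
  have "of_int (A' * B - A * B') * z + of_int (A' * C - A * C') =
        of_int A' * (of_int A * z\<^sup>2 + of_int B * z + of_int C) -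
        of_int A * (of_int A' * z\<^sup>2 + of_int B' * z + of_int C')"
    by (simp add: algebra_simps)
  also have "\<dots> = 0" using root root0 by simp
  finally have AB: "A' * B = A * B'" and AC: "A' * C = A * C'"
    using int_linear_nonreal_root[OF z, of "A' * B - A * B'" "A' * C - A * C'"] by auto
  have "A \<noteq> 0"
  proof
    assume "A = 0"
    with root0 gcd1 show False using int_linear_nonreal_root[OF z, of B C] by auto
  qed
  have "A * (B' * C) = (A * B') * C" by simp
  also have "\<dots> = B * (A' * C)" unfolding AB[symmetric] by simp
  also have "\<dots> = A * (B * C')" unfolding AC by simp
  finally have "A * (B' * C) = A * (B * C')" .
  with \<open>A \<noteq> 0\<close> have BC: "B' * C = B * C'" by simp
  obtain u v where uv: "u * A + v * gcd B C = 1" using bezout_int[of A "gcd B C"] gcd1 by auto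
  obtain s t where st: "s * B + t * C = gcd B C" using bezout_int by blast
  have one: "u * A + v * s * B + v * t * C = 1"
    using uv unfolding st[symmetric] by (simp add: algebra_simps)
  \<comment> \<open>The ratio of the two triples, written as the Bezout combination of the new
    coefficients so that it is visibly an integer.\<close>
  define k where "k = u * A' + v * s * B' + v * t * C'"
  show thesis
  proof
    show "A' = k * A"
    proof -
      have "k * A = u * A * A' + v * s * (A * B') + v * t * (A * C')" by (simp add: k_def algebra_simps)
      also have "\<dots> = A' * (u * A + v * s * B + v * t * C)" unfolding AB[symmetric] AC[symmetric] by (simp add: algebra_simps)
      finally show ?thesis using one by simp
    qed
    show "B' = k * B"
    proof -
      have "k * B = u * (A' * B) + v * s * B * B' + v * t * (B * C')" by (simp add: k_def algebra_simps)
      also have "\<dots> = B' * (u * A + v * s * B + v * t * C)" unfolding AB BC[symmetric] by (simp add: algebra_simps)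
      finally show ?thesis using one by simp
    qed
    show "C' = k * C"
    proof -
      have "k * C = u * (A' * C) + v * s * (B' * C) + v * t * C * C'" by (simp add: k_def algebra_simps)
      also have "\<dots> = C' * (u * A + v * s * B + v * t * C)" unfolding AC BC by (simp add: algebra_simps)
      finally show ?thesis using one by simp
    qed
  qed
qed

lemma has_neg_disc_unique:
  assumes "z \<notin> \<real>" "has_neg_disc z D" "has_neg_disc z D'"
  shows "D = D'"
proof -
  obtain A B C A' B' C' where
    p: "primitive_form_root z A B C" "D = 4 * A * C - B\<^sup>2" and
    p': "primitive_form_root z A' B' C'" "D' = 4 * A' * C' - B'\<^sup>2"
    using assms(2,3) unfolding has_neg_disc_def by blast
  obtain k where k: "A' = k * A" "B' = k * B" "C' = k * C"
    using primitive_form_root_multiple[OF assms(1) p(1)] p'(1)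
    unfolding primitive_form_root_def by metis
  have "k dvd gcd A' (gcd B' C')" using k by simp
  moreover have "gcd A' (gcd B' C') = 1" using p'(1) by (simp add: primitive_form_root_def)
  ultimately have "\<bar>k\<bar> = 1" by (metis zdvd1_eq)
  hence "k\<^sup>2 = 1" by (metis one_power2 power2_abs)
  moreover have "D' = k\<^sup>2 * D" unfolding p(2) p'(2) k by (simp add: power2_eq_square algebra_simps)
  ultimately show ?thesis by simp
qed

lemma int_triple_primitive_part:
  fixes a b c :: int
  assumes "a \<noteq> 0"
  obtains g A B C where "g > 0" "a = g * A" "b = g * B" "c = g * C" "gcd A (gcd B C) = 1"
proof -
  define g where "g = gcd a (gcd b c)"
  have "g > 0" using assms by (simp add: g_def)
  obtain A B C where ABC: "a = g * A" "b = g * B" "c = g * C"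
  proof -
    have "g dvd a" "g dvd b" "g dvd c" by (auto simp: g_def intro: dvd_trans)
    thus thesis using that by (auto elim!: dvdE)
  qed
  have "g * gcd A (gcd B C) = g"
    using \<open>g > 0\<close> g_def unfolding ABC by (metis abs_of_pos gcd_mult_distrib_int)
  hence "gcd A (gcd B C) = 1" using \<open>g > 0\<close> by simp
  with \<open>g > 0\<close> ABC show thesis by (rule that)
qed

lemma imaginary_quadratic_primitive_form:
  assumes "imaginary_quadratic z"
  obtains A B C where "primitive_form_root z A B C"
proof -
  obtain a b c :: int where abc: "a \<noteq> 0" "of_int a * z\<^sup>2 + of_int b * z + of_int c = 0"
    using assms unfolding imaginary_quadratic_def by blast
  obtain g A B C where g: "g > 0" "a = g * A" "b = g * B" "c = g * C" and "gcd A (gcd B C) = 1"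
    using int_triple_primitive_part[OF abc(1)] by metis
  moreover have "of_int g * (of_int A * z\<^sup>2 + of_int B * z + of_int C) = 0"
    using abc(2) unfolding g(2-4) by (simp add: algebra_simps)
  ultimately show thesis using that[of A B C] unfolding primitive_form_root_def by simp
qed

text \<open>Complete the square: \<open>2 * A * z + B\<close> is not real, but its square is the
  integer \<open>B\<^sup>2 - 4 * A * C\<close>. So it is purely imaginary and its square is
  negative.\<close>

lemma neg_disc_pos:
  assumes z: "z \<notin> \<real>" and "primitive_form_root z A B C"
  shows "4 * A * C - B\<^sup>2 > 0"
proof -
  have root: "of_int A * z\<^sup>2 + of_int B * z + of_int C = 0" and g: "gcd A (gcd B C) = 1"
    using assms(2) by (auto simp: primitive_form_root_def)
  have "A \<noteq> 0"
  proof
    assume "A = 0"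
    with root g show False using int_linear_nonreal_root[OF z, of B C] by auto
  qed
  have "Im z \<noteq> 0" using z by (simp add: complex_is_Real_iff)
  define w where "w = 2 * of_int A * z + of_int B"
  have "w\<^sup>2 = 4 * of_int A * (of_int A * z\<^sup>2 + of_int B * z + of_int C) - of_int (4 * A * C - B\<^sup>2)"
    by (simp add: w_def power2_eq_square algebra_simps)
  hence w2: "w\<^sup>2 = - of_int (4 * A * C - B\<^sup>2)" using root by simp
  have Imw: "Im w \<noteq> 0" using \<open>A \<noteq> 0\<close> \<open>Im z \<noteq> 0\<close> by (simp add: w_def)
  have "Im (w\<^sup>2) = 0" unfolding w2 by simp
  hence "Re w = 0" using Imw by (simp add: power2_eq_square)
  hence "Re (w\<^sup>2) < 0" using Imw by (simp add: power2_eq_square) (metis not_real_square_gt_zero)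
  thus ?thesis unfolding w2 by (simp, metis of_int_less_iff of_int_mult of_int_numeral of_int_power)
qed

lemma primitive_form_root_moebius:
  fixes x r y t :: int
  assumes prim: "primitive_form_root z A B C"
    and det: "x * t - r * y = 1" and nz: "of_int y * w + of_int t \<noteq> (0 :: complex)"
    and z: "z = (of_int x * w + of_int r) / (of_int y * w + of_int t)"
  defines "A' \<equiv> A * x\<^sup>2 + B * x * y + C * y\<^sup>2"
    and "B' \<equiv> 2 * A * x * r + B * (x * t + r * y) + 2 * C * y * t"
    and "C' \<equiv> A * r\<^sup>2 + B * r * t + C * t\<^sup>2"
  shows "primitive_form_root w A' B' C'"
    and "4 * A' * C' - B'\<^sup>2 = 4 * A * C - B\<^sup>2"
proof -
  have root: "of_int A * z\<^sup>2 + of_int B * z + of_int C = 0" and g: "gcd A (gcd B C) = 1"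
    using prim by (auto simp: primitive_form_root_def)
  let ?n = "of_int x * w + of_int r" and ?e = "of_int y * w + of_int t"
  have ze: "z * ?e = ?n" using nz z by simp
  have "of_int A' * w\<^sup>2 + of_int B' * w + of_int C' =
        of_int A * ?n\<^sup>2 + of_int B * ?n * ?e + of_int C * ?e\<^sup>2"
    by (simp add: A'_def B'_def C'_def power2_eq_square algebra_simps)
  also have "\<dots> = (of_int A * z\<^sup>2 + of_int B * z + of_int C) * ?e\<^sup>2"
    unfolding ze[symmetric] by (simp add: power2_eq_square algebra_simps)
  also have "\<dots> = 0" using root by simp
  finally have root': "of_int A' * w\<^sup>2 + of_int B' * w + of_int C' = 0" .
  have sq: "(x * t - r * y)\<^sup>2 = 1" using det by simp
  \<comment> \<open>The inverse substitution recovers \<open>A\<close>, \<open>B\<close>,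
    \<open>C\<close> as integral combinations of \<open>A'\<close>, \<open>B'\<close>,
    \<open>C'\<close>. A common divisor of the new coefficients therefore divides the old ones, and
    primitivity is preserved.\<close>
  have "A' * t\<^sup>2 - B' * t * y + C' * y\<^sup>2 = A * (x * t - r * y)\<^sup>2"
    by (simp add: A'_def B'_def C'_def power2_eq_square algebra_simps)
  hence A: "A = A' * t\<^sup>2 - B' * t * y + C' * y\<^sup>2" using sq by simp
  have "- 2 * A' * t * r + B' * (x * t + r * y) - 2 * C' * x * y = B * (x * t - r * y)\<^sup>2"
    by (simp add: A'_def B'_def C'_def power2_eq_square algebra_simps)
  hence B: "B = - 2 * A' * t * r + B' * (x * t + r * y) - 2 * C' * x * y" using sq by simp
  have "A' * r\<^sup>2 - B' * r * x + C' * x\<^sup>2 = C * (x * t - r * y)\<^sup>2"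
    by (simp add: A'_def B'_def C'_def power2_eq_square algebra_simps)
  hence C: "C = A' * r\<^sup>2 - B' * r * x + C' * x\<^sup>2" using sq by simp
  let ?g = "gcd A' (gcd B' C')"
  have d: "?g dvd A'" "?g dvd B'" "?g dvd C'"
    by (auto intro: dvd_trans)
  have "?g dvd A" unfolding A using d by (intro dvd_add dvd_diff dvd_mult2) auto
  moreover have "?g dvd B" unfolding B using d
    by (intro dvd_add dvd_diff; (simp add: dvd_mult dvd_mult2)?)
  moreover have "?g dvd C" unfolding C using d by (intro dvd_add dvd_diff dvd_mult2) auto
  ultimately have "?g dvd 1" using g by (metis gcd_greatest)
  hence "?g = 1" by simp
  with root' show "primitive_form_root w A' B' C'" by (simp add: primitive_form_root_def)
  have "4 * A' * C' - B'\<^sup>2 = (4 * A * C - B\<^sup>2) * (x * t - r * y)\<^sup>2"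
    by (simp add: A'_def B'_def C'_def power2_eq_square algebra_simps)
  thus "4 * A' * C' - B'\<^sup>2 = 4 * A * C - B\<^sup>2" using sq by simp
qed

section \<open>Values of primitive forms coprime to a given integer\<close>

lemma not_coprime_int_prime:
  fixes a b :: int
  assumes "\<not> coprime a b" "b \<noteq> 0"
  obtains p where "prime p" "p dvd a" "p dvd b"
proof -
  have "\<not> is_unit (gcd a b)" "gcd a b \<noteq> 0" using assms by (simp_all add: coprime_iff_gcd_eq_1)
  then obtain p where "p dvd gcd a b" "prime p" using prime_divisor_exists by blast
  thus thesis using that by simp
qed

text \<open>Each prime divisor \<open>p\<close> of \<open>M\<close> is kept from dividing the value
  by leaving one term of the form nonzero modulo \<open>p\<close>: the first if \<open>p\<close>
  does not divide \<open>A\<close>, the last if it divides \<open>A\<close> but not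
  \<open>C\<close>, and the middle one if it divides both, since then primitivity gives a
  \<open>B\<close> prime to \<open>p\<close>.\<close>

lemma primitive_form_represents_coprime:
  fixes A B C M :: int
  assumes g: "gcd A (gcd B C) = 1" and M: "M \<noteq> 0"
  obtains x y where "coprime x y" "coprime (A * x\<^sup>2 + B * x * y + C * y\<^sup>2) M"
proof -
  define P where "P = prime_factors M"
  have fin: "finite P" by (simp add: P_def)
  have primeP: "prime p" if "p \<in> P" for p using that by (auto simp: P_def)
  \<comment> \<open>The prime divisors of \<open>M\<close> that divide \<open>x\<close> and those
    that divide \<open>y\<close> form disjoint sets, so \<open>x\<close> and \<open>y\<close> are
    coprime. Primes dividing both \<open>A\<close> and \<open>C\<close> go into neither
    product.\<close>
  define x where "x = \<Prod>{p \<in> P. p dvd A \<and> \<not> p dvd C}"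
  define y where "y = \<Prod>{p \<in> P. \<not> p dvd A}"
  have dvdx: "p dvd x \<longleftrightarrow> p \<in> P \<and> p dvd A \<and> \<not> p dvd C" if "prime p" for p
  proof -
    have "p dvd x \<longleftrightarrow> (\<exists>q \<in> {p \<in> P. p dvd A \<and> \<not> p dvd C}. p dvd q)"
      unfolding x_def using fin that by (subst prime_dvd_prod_iff) auto
    thus ?thesis using that primeP by (metis (no_types, lifting) mem_Collect_eq primes_dvd_imp_eq dvd_refl)
  qed
  have dvdy: "p dvd y \<longleftrightarrow> p \<in> P \<and> \<not> p dvd A" if "prime p" for p
  proof -
    have "p dvd y \<longleftrightarrow> (\<exists>q \<in> {p \<in> P. \<not> p dvd A}. p dvd q)"
      unfolding y_def using fin that by (subst prime_dvd_prod_iff) auto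
    thus ?thesis using that primeP by (metis (no_types, lifting) mem_Collect_eq primes_dvd_imp_eq dvd_refl)
  qed
  show thesis
  proof
    have "y \<noteq> 0"
      unfolding y_def using fin primeP[of 0] by (auto simp: prod_zero_iff)
    show "coprime x y"
    proof (rule ccontr)
      assume "\<not> coprime x y"
      then obtain p where "prime p" "p dvd x" "p dvd y"
        using not_coprime_int_prime \<open>y \<noteq> 0\<close> by blast
      thus False using dvdx dvdy by blast
    qed
    let ?N = "A * x\<^sup>2 + B * x * y + C * y\<^sup>2"
    show "coprime ?N M"
    proof (rule ccontr)
      assume "\<not> coprime ?N M"
      then obtain p where p: "prime p" "p dvd ?N" "p dvd M"
        using not_coprime_int_prime M by blast
      have pP: "p \<in> P" using p M by (auto simp: P_def prime_factors_dvd)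
      have *: "p dvd u * v \<longleftrightarrow> p dvd u \<or> p dvd v" for u v using p(1) by (rule prime_dvd_mult_iff)
      consider "\<not> p dvd A" | "p dvd A" "\<not> p dvd C" | "p dvd A" "p dvd C" by blast
      thus False
      proof cases
        case 1
        hence "\<not> p dvd x" "p dvd y" using dvdx dvdy p(1) pP by auto
        hence "p dvd A * x\<^sup>2" using p(2) by (simp add: dvd_add_left_iff power2_eq_square add.assoc)
        with 1 \<open>\<not> p dvd x\<close> show False by (simp add: * power2_eq_square)
      next
        case 2
        hence "p dvd x" "\<not> p dvd y" using dvdx dvdy p(1) pP by auto
        hence "p dvd C * y\<^sup>2" using p(2) 2 by (simp add: dvd_add_right_iff power2_eq_square)
        with 2 \<open>\<not> p dvd y\<close> show False by (simp add: * power2_eq_square)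
      next
        case 3
        hence n: "\<not> p dvd x" "\<not> p dvd y" using dvdx dvdy p(1) pP by auto
        have "p dvd B * x * y" using p(2) 3
          by (simp add: dvd_add_right_iff dvd_add_left_iff)
        with n have "p dvd B" by (simp add: *)
        with 3 have "p dvd gcd A (gcd B C)" by simp
        with g p(1) show False by auto
      qed
    qed
  qed
qed

text \<open>
  Minimality of the dilation factor enters as \<open>d \<le> a\<close>: the content of the transformed form
  divides \<open>d\<^sup>2\<close>, whereas its discriminant is \<open>(a d)\<^sup>2\<close> times the original one.
\<close>

lemma neg_disc_affine_less:
  fixes a b d :: int
  assumes s: "s \<notin> \<real>" and prim: "primitive_form_root s A B C" and cop: "coprime A (a * d)"
    and d: "d > 0" and ad: "d \<le> a" and g: "gcd d (gcd a b) = 1" and nt: "a \<noteq> 1 \<or> d \<noteq> 1"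
    and D': "has_neg_disc ((of_int a * s + of_int b) / of_int d) D'"
  shows "4 * A * C - B\<^sup>2 < D'"
proof -
  define w where "w = (of_int a * s + of_int b) / of_int d"
  have w: "w \<notin> \<real>" using s d ad by (simp add: w_def complex_is_Real_iff complex_eq_iff Im_divide)
  have root: "of_int A * s\<^sup>2 + of_int B * s + of_int C = 0" and gABC: "gcd A (gcd B C) = 1"
    using prim by (auto simp: primitive_form_root_def)
  \<comment> \<open>The form of \<open>w\<close>, not yet primitive: substitute
    \<open>s = (d * w - b) / a\<close> and multiply by \<open>a\<^sup>2\<close>. Its content will be
    \<open>k\<close> up to sign.\<close>
  define A1 where "A1 = A * d\<^sup>2"
  define B1 where "B1 = d * (B * a - 2 * A * b)"
  define C1 where "C1 = A * b\<^sup>2 - B * a * b + C * a\<^sup>2"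
  have dw: "of_int d * w = of_int a * s + of_int b" using d by (simp add: w_def)
  have "of_int A1 * w\<^sup>2 + of_int B1 * w + of_int C1 =
     of_int A * (of_int d * w)\<^sup>2 + of_int (B * a - 2 * A * b) * (of_int d * w) + of_int C1"
    by (simp add: A1_def B1_def power2_eq_square algebra_simps)
  also have "\<dots> = of_int (a\<^sup>2) * (of_int A * s\<^sup>2 + of_int B * s + of_int C)"
    unfolding dw by (simp add: C1_def power2_eq_square algebra_simps)
  also have "\<dots> = 0" using root by simp
  finally have root1: "of_int A1 * w\<^sup>2 + of_int B1 * w + of_int C1 = 0" .
  obtain A2 B2 C2 where p2: "primitive_form_root w A2 B2 C2" and D2: "D' = 4 * A2 * C2 - B2\<^sup>2"
    using D' unfolding has_neg_disc_def w_def by blast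
  obtain k where k: "A1 = k * A2" "B1 = k * B2" "C1 = k * C2"
    using primitive_form_root_multiple[OF w p2 root1] by blast
  have kd: "k dvd A1" "k dvd B1" "k dvd C1" using k by auto
  have "k \<noteq> 0"
  proof
    assume "k = 0"
    with k have "A1 = 0" by simp
    hence "A = 0" using d by (simp add: A1_def)
    with root gABC show False using int_linear_nonreal_root[OF s, of B C] by auto
  qed
  \<comment> \<open>A common prime of \<open>A\<close> and \<open>k\<close> is prime to
    \<open>a * d\<close>, so it would pass from \<open>B1\<close> to \<open>B\<close> and then from
    \<open>C1\<close> to \<open>C\<close>, against primitivity.\<close>
  have "coprime A k"
  proof (rule ccontr)
    assume "\<not> coprime A k"
    then obtain p where p: "prime p" "p dvd A" "p dvd k"
      using not_coprime_int_prime \<open>k \<noteq> 0\<close> by blast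
    have *: "p dvd u * v \<longleftrightarrow> p dvd u \<or> p dvd v" for u v using p(1) by (rule prime_dvd_mult_iff)
    have n: "\<not> p dvd a" "\<not> p dvd d"
      using p cop by (auto simp: coprime_def) 
    have "p dvd B1" "p dvd C1" using p kd by (auto intro: dvd_trans)
    hence "p dvd B * a - 2 * A * b" using n by (simp add: B1_def *)
    hence "p dvd B * a" using p(2) by (simp add: dvd_diff_left_iff)
    hence pB: "p dvd B" using n by (simp add: *)
    have "C * a\<^sup>2 = C1 - A * b\<^sup>2 + B * a * b" by (simp add: C1_def)
    also have "p dvd \<dots>" using \<open>p dvd C1\<close> pB p(2) by simp
    finally have "p dvd C" using n by (simp add: * power2_eq_square)
    with pB p(2) have "p dvd gcd A (gcd B C)" by simp
    with gABC p(1) show False by auto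
  qed
  have "k dvd d\<^sup>2" using kd(1) \<open>coprime A k\<close> unfolding A1_def
    by (metis coprime_commute coprime_dvd_mult_right_iff)
  hence kle: "\<bar>k\<bar> \<le> d\<^sup>2" using d by (metis abs_power2 dvd_imp_le_int power_not_zero less_irrefl)
  have dd: "d\<^sup>2 \<le> a * d" using d ad by (simp add: power2_eq_square)
  \<comment> \<open>Equality forces \<open>a = d\<close> and
    \<open>\<bar>k\<bar> = d\<^sup>2\<close>. Then \<open>d\<close> divides \<open>C1\<close>, hence
    \<open>b\<^sup>2\<close>, although \<open>d\<close> and \<open>b\<close> are coprime. This
    leaves only \<open>a = d = 1\<close>, which is excluded.\<close>
  have klt: "\<bar>k\<bar> < a * d"
  proof (rule ccontr)
    assume "\<not> \<bar>k\<bar> < a * d"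
    with kle dd have e: "\<bar>k\<bar> = d\<^sup>2" "a * d = d * d"
      unfolding power2_eq_square by linarith+
    hence "a = d" using d by simp
    with g have cdb: "coprime d b" by (simp add: coprime_iff_gcd_eq_1 gcd.assoc[symmetric])
    have "d dvd k" using e(1) by (metis dvd_abs_iff dvd_triv_left power2_eq_square)
    hence "d dvd C1" using kd(3) by (rule dvd_trans)
    moreover have "C1 = A * b\<^sup>2 + d * (C * d - B * b)"
      by (simp add: C1_def \<open>a = d\<close> power2_eq_square algebra_simps)
    ultimately have "d dvd A * b\<^sup>2" by (simp add: dvd_add_left_iff)
    moreover have "coprime d A" using cop by (simp add: coprime_commute)
    ultimately have "d dvd b\<^sup>2" by (simp add: coprime_dvd_mult_right_iff)
    moreover have "coprime d (b\<^sup>2)" using cdb by simp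
    ultimately have "d dvd 1" by (metis coprime_def dvd_refl)
    with d have "d = 1" by simp
    with nt \<open>a = d\<close> show False by simp
  qed
  have Dp: "4 * A * C - B\<^sup>2 > 0" using neg_disc_pos[OF s prim] .
  have eq: "k\<^sup>2 * D' = (a * d)\<^sup>2 * (4 * A * C - B\<^sup>2)"
  proof -
    have "k\<^sup>2 * D' = 4 * A1 * C1 - B1\<^sup>2" by (simp add: k D2 power2_eq_square algebra_simps)
    also have "\<dots> = (a * d)\<^sup>2 * (4 * A * C - B\<^sup>2)"
      by (simp add: A1_def B1_def C1_def power2_eq_square algebra_simps)
    finally show ?thesis .
  qed
  have "k\<^sup>2 < (a * d)\<^sup>2" using klt by (metis abs_ge_zero power2_abs power_strict_mono zero_less_numeral)
  hence "k\<^sup>2 * (4 * A * C - B\<^sup>2) < k\<^sup>2 * D'" unfolding eq using Dp by simp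
  thus ?thesis using \<open>k \<noteq> 0\<close> by simp
qed

subsection \<open>Fundamental domain and maximum modulus\<close>

abbreviation \<H> :: "complex set" where "\<H> \<equiv> upper_half_plane"

lemma open_upper_half_plane: "open \<H>"
  unfolding upper_half_plane_def by (rule open_halfspace_Im_gt)

lemma connected_upper_half_plane: "connected \<H>"
  unfolding upper_half_plane_def by (intro convex_connected convex_halfspace_Im_gt)

lemma upper_half_plane_not_real: "z \<in> \<H> \<Longrightarrow> z \<notin> \<real>"
  by (auto simp: upper_half_plane_def complex_is_Real_iff)

lemma denom_nonzero:
  fixes c d :: int
  assumes "z \<in> \<H>" "c \<noteq> 0 \<or> d \<noteq> 0"
  shows "of_int c * z + of_int d \<noteq> 0"
proof
  assume "of_int c * z + of_int d = 0"
  hence "Im (of_int c * z + of_int d) = 0" "Re (of_int c * z + of_int d) = 0" by simp_all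
  thus False using assms by (auto simp: upper_half_plane_def)
qed

lemma Im_moebius:
  fixes a b c d :: int
  assumes "a * d - b * c = 1"
  shows "Im ((of_int a * z + of_int b) / (of_int c * z + of_int d)) =
         Im z / (cmod (of_int c * z + of_int d))\<^sup>2"
proof -
  have "Im ((of_int a * z + of_int b) / (of_int c * z + of_int d)) =
        of_int (a * d - b * c) * Im z / (cmod (of_int c * z + of_int d))\<^sup>2"
    by (simp add: Im_divide cmod_power2 algebra_simps)
  thus ?thesis using assms by simp
qed

lemma moebius_in_upper_half_plane:
  fixes a b c d :: int
  assumes "a * d - b * c = 1" "z \<in> \<H>"
  shows "(of_int a * z + of_int b) / (of_int c * z + of_int d) \<in> \<H>"
proof -
  have "c \<noteq> 0 \<or> d \<noteq> 0" using assms(1) by auto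
  with assms show ?thesis using denom_nonzero[OF assms(2), of c d]
    by (simp add: upper_half_plane_def Im_moebius)
qed

text \<open>The orbit relation of the modular group on \<open>\<H>\<close>, with integer entries in
  place of the rational matrices of \<open>SL2_Z\<close>, so that integral forms can be transported
  along it.\<close>

definition modular_equiv :: "complex \<Rightarrow> complex \<Rightarrow> bool" where
  "modular_equiv z w \<longleftrightarrow> (\<exists>a b c d :: int. a * d - b * c = 1 \<and>
     w = (of_int a * z + of_int b) / (of_int c * z + of_int d))"

lemma modular_equiv_upper_half_plane: "modular_equiv z w \<Longrightarrow> z \<in> \<H> \<Longrightarrow> w \<in> \<H>"
  unfolding modular_equiv_def using moebius_in_upper_half_plane by blast

text \<open>The imaginary part bounds \<open>c\<close>, and then the real part bounds
  \<open>d\<close>. This supplies the minimum used in the reduction to the fundamental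
  domain.\<close>

lemma finite_bounded_denominators:
  assumes z: "z \<in> \<H>"
  shows "finite {(c :: int, d :: int). cmod (of_int c * z + of_int d) \<le> r}"
proof -
  have y: "Im z > 0" using z by (simp add: upper_half_plane_def)
  define N where "N = \<lceil>r / Im z\<rceil>"
  define M where "M = \<lceil>r + of_int N * \<bar>Re z\<bar>\<rceil>"
  have "{(c, d). cmod (of_int c * z + of_int d) \<le> r} \<subseteq> {-N..N} \<times> {-M..M}"
  proof safe
    fix c d :: int assume le: "cmod (of_int c * z + of_int d) \<le> r"
    have "\<bar>Im (of_int c * z + of_int d)\<bar> \<le> r" using le abs_Im_le_cmod order_trans by blast
    hence "\<bar>of_int c\<bar> * Im z \<le> r" using y by (simp add: abs_mult)
    hence "\<bar>of_int c\<bar> \<le> r / Im z" using y by (simp add: field_simps)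
    hence "real_of_int \<bar>c\<bar> \<le> r / Im z" by simp
    hence c: "\<bar>c\<bar> \<le> N" unfolding N_def by linarith
    have "\<bar>Re (of_int c * z + of_int d)\<bar> \<le> r" using le abs_Re_le_cmod order_trans by blast
    hence "\<bar>of_int c * Re z + of_int d\<bar> \<le> r" by simp
    hence "\<bar>real_of_int d\<bar> \<le> r + \<bar>of_int c * Re z\<bar>" by linarith
    also have "\<bar>of_int c * Re z\<bar> \<le> of_int N * \<bar>Re z\<bar>"
      using c unfolding abs_mult by (intro mult_right_mono) linarith+
    finally have d: "\<bar>d\<bar> \<le> M" unfolding M_def by linarith
    show "c \<in> {-N..N}" "d \<in> {-M..M}" using c d by auto
  qed
  thus ?thesis by (rule finite_subset) auto
qed

text \<open>Choose a coprime pair with \<open>\<bar>c z + d\<bar>\<close> minimal, complete it to a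
  unimodular matrix and translate into the strip. Minimality against the upper row
  \<open>(a, b)\<close> makes the image \<open>w\<close> have modulus at least 1, which in the strip
  bounds its imaginary part from below.\<close>

lemma modular_equiv_fundamental_domain:
  assumes z: "z \<in> \<H>"
  obtains w where "modular_equiv z w" "\<bar>Re w\<bar> \<le> 1/2" "1/2 \<le> Im w"
proof -
  define N where "N = (\<lambda>(c :: int, d :: int). cmod (of_int c * z + of_int d))"
  \<comment> \<open>The bound 1 is the value at the pair \<open>(0, 1)\<close>; it makes the set
    finite and nonempty without affecting the minimum over all coprime pairs.\<close>
  define T where "T = {(c, d). coprime c d \<and> N (c, d) \<le> 1}"
  have "finite {(c, d). N (c, d) \<le> 1}" unfolding N_def using finite_bounded_denominators[OF z] by simp
  hence "finite T" by (rule finite_subset[rotated]) (auto simp: T_def)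
  moreover have "(0, 1) \<in> T" by (simp add: T_def N_def)
  ultimately obtain p where p: "p \<in> T" "\<And>q. q \<in> T \<Longrightarrow> N p \<le> N q"
    by (metis arg_min_if_finite(1) arg_min_least empty_iff)
  obtain c d where cd: "p = (c, d)" by (cases p)
  have cop: "coprime c d" and N1: "N (c, d) \<le> 1" using p(1) cd by (auto simp: T_def)
  have min: "N (c, d) \<le> N (c', d')" if "coprime c' d'" for c' d'
    using p(2)[of "(c', d')"] that N1 cd by (cases "N (c', d') \<le> 1") (auto simp: T_def)
  obtain u v where uv: "u * c + v * d = 1" using bezout_int[of c d] cop by auto
  define z1 where "z1 = (of_int v * z + of_int (-u)) / (of_int c * z + of_int d)"
  define n where "n = - round (Re z1)"
  define a where "a = v + n * c"
  define b where "b = n * d - u"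
  have det: "a * d - b * c = 1" using uv by (simp add: a_def b_def algebra_simps)
  define e where "e = of_int c * z + of_int d"
  have e: "e \<noteq> 0" unfolding e_def using denom_nonzero[OF z, of c d] det by fastforce
  define w where "w = (of_int a * z + of_int b) / e"
  have w: "w = z1 + of_int n"
  proof -
    have "of_int a * z + of_int b = (of_int v * z + of_int (-u)) + of_int n * e"
      by (simp add: a_def b_def e_def algebra_simps)
    thus ?thesis using e unfolding w_def z1_def e_def[symmetric] by (simp add: add_divide_distrib)
  qed
  have Rew: "\<bar>Re w\<bar> \<le> 1/2"
    using of_int_round_abs_le[of "Re z1"] by (simp add: w n_def abs_minus_commute)
  have equ: "modular_equiv z w" unfolding modular_equiv_def w_def e_def using det by blast
  hence wH: "w \<in> \<H>" using modular_equiv_upper_half_plane z by blast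
  have "coprime a b"
  proof (rule coprimeI)
    fix k assume "k dvd a" "k dvd b"
    hence "k dvd a * d - b * c" by simp
    thus "is_unit k" using det by simp
  qed
  hence "N (c, d) \<le> N (a, b)" by (rule min)
  moreover have "N (a, b) = cmod w * N (c, d)" using e
    by (simp add: N_def w_def e_def norm_divide)
  moreover have "N (c, d) > 0" using e by (simp add: N_def e_def)
  ultimately have "cmod w \<ge> 1" by simp
  hence "1 \<le> (cmod w)\<^sup>2" by simp
  hence "1 \<le> (Re w)\<^sup>2 + (Im w)\<^sup>2" by (simp add: cmod_power2)
  moreover have "(Re w)\<^sup>2 \<le> (1/2)\<^sup>2" using Rew by (metis abs_ge_zero power2_abs power_mono)
  ultimately have "(1/2)\<^sup>2 \<le> (Im w)\<^sup>2" by (simp add: power2_eq_square)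
  moreover have "Im w > 0" using wH by (simp add: upper_half_plane_def)
  ultimately have "1/2 \<le> Im w" using power2_le_imp_le by (metis less_eq_real_def)
  with equ Rew show thesis using that by blast
qed

text \<open>
  Maximum modulus: on the fundamental domain \<open>|h - l|\<close> attains its maximum, because it
  vanishes at the cusp.
\<close>

lemma modular_invariant_holomorphic_constant:
  assumes holo: "h holomorphic_on \<H>"
    and inv: "\<And>z w. z \<in> \<H> \<Longrightarrow> modular_equiv z w \<Longrightarrow> h w = h z"
    and lim: "(h \<longlongrightarrow> l) (filtercomap Im at_top)"
    and z: "z \<in> \<H>"
  shows "h z = l"
proof (rule ccontr)
  assume ne: "h z \<noteq> l"
  define k where "k = (\<lambda>z. h z - l)"
  have kinv: "k w = k z" if "z \<in> \<H>" "modular_equiv z w" for z w using inv[OF that] by (simp add: k_def)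
  have klim: "(k \<longlongrightarrow> 0) (filtercomap Im at_top)" unfolding k_def using lim by (simp add: LIM_zero)
  have kholo: "k holomorphic_on \<H>" unfolding k_def by (intro holomorphic_intros holo)
  obtain z0 where z0: "modular_equiv z z0" "\<bar>Re z0\<bar> \<le> 1/2" "1/2 \<le> Im z0"
    using modular_equiv_fundamental_domain[OF z] by blast
  have k0: "cmod (k z0) > 0" using kinv[OF z z0(1)] ne by (simp add: k_def)
  have "eventually (\<lambda>z. cmod (k z) < cmod (k z0)) (filtercomap Im at_top)"
    using tendstoD[OF klim k0] by simp
  then obtain Y where Y: "\<And>z. Im z \<ge> Y \<Longrightarrow> cmod (k z) < cmod (k z0)"
    by (auto simp: eventually_filtercomap eventually_at_top_linorder)
  define K where "K = cbox (Complex (-1/2) (1/2)) (Complex (1/2) (max Y 1))"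
  have K: "w \<in> K \<longleftrightarrow> \<bar>Re w\<bar> \<le> 1/2 \<and> 1/2 \<le> Im w \<and> Im w \<le> max Y 1" for w
    by (auto simp: K_def in_cbox_complex_iff)
  have KH: "K \<subseteq> \<H>" by (auto simp: K upper_half_plane_def)
  have "z0 \<in> K" using z0 Y[of z0] by (force simp: K)
  obtain m where m: "m \<in> K" "\<And>w. w \<in> K \<Longrightarrow> cmod (k w) \<le> cmod (k m)"
  proof -
    have "continuous_on K (\<lambda>w. cmod (k w))"
      by (intro continuous_on_norm holomorphic_on_imp_continuous_on holomorphic_on_subset[OF kholo KH])
    moreover have "compact K" by (simp add: K_def)
    ultimately show thesis using continuous_attains_sup[of K "\<lambda>w. cmod (k w)"] \<open>z0 \<in> K\<close> that by blast
  qed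
  have max: "cmod (k w) \<le> cmod (k m)" if wH: "w \<in> \<H>" for w
  proof -
    obtain w' where w': "modular_equiv w w'" "\<bar>Re w'\<bar> \<le> 1/2" "1/2 \<le> Im w'"
      using modular_equiv_fundamental_domain[OF wH] by blast
    have "cmod (k w') \<le> cmod (k m)"
    proof (cases "w' \<in> K")
      case False
      hence "Im w' \<ge> Y" using w' by (auto simp: K)
      hence "cmod (k w') < cmod (k z0)" by (rule Y)
      also have "\<dots> \<le> cmod (k m)" using m(2) \<open>z0 \<in> K\<close> by blast
      finally show ?thesis by simp
    qed (use m in auto)
    thus ?thesis using kinv[OF wH w'(1)] by simp
  qed
  have "k constant_on \<H>"
    by (rule maximum_modulus_principle[OF kholo open_upper_half_plane connected_upper_half_plane
          open_upper_half_plane order_refl, of m]) (use m KH max in auto)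
  then obtain c where c: "\<And>w. w \<in> \<H> \<Longrightarrow> k w = c" by (auto simp: constant_on_def)
  \<comment> \<open>The height \<open>max Y 1\<close> puts a point in \<open>\<H>\<close> and in the
    region where \<open>k\<close> is smaller in modulus than at \<open>z0\<close>, contradicting
    constancy.\<close>
  have "k (Complex 0 (max Y 1)) = c" "k z0 = c"
    using \<open>z0 \<in> K\<close> KH by (auto intro!: c simp: upper_half_plane_def)
  with Y[of "Complex 0 (max Y 1)"] show False by simp
qed

subsection \<open>Zeros and poles of modular functions\<close>

text \<open>The modulus of the exponential is \<open>exp (- 2 * pi * Im z)\<close>. Statements about
  \<open>q\<close> near 0 thus become statements near the cusp, which is encoded by
  \<open>filtercomap Im at_top\<close>.\<close>

lemma nome_filterlim:
  "filterlim (\<lambda>z. exp (2 * of_real pi * \<i> * z)) (at 0) (filtercomap Im at_top)"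
proof (rule filterlim_atI)
  have "((\<lambda>y. exp (- 2 * pi * y)) \<longlongrightarrow> 0) at_top" by real_asymp
  hence "((\<lambda>z. exp (- 2 * pi * Im z)) \<longlongrightarrow> 0) (filtercomap Im at_top)"
    by (rule filterlim_compose) (rule filterlim_filtercomap)
  thus "((\<lambda>z. exp (2 * of_real pi * \<i> * z)) \<longlongrightarrow> 0) (filtercomap Im at_top)"
    by (intro tendsto_norm_zero_cancel[of "\<lambda>z. exp (2 * of_real pi * \<i> * z)"]) simp
qed simp

lemma has_q_expansion_eventually:
  assumes "has_q_expansion f L"
  shows "eventually (\<lambda>z. f z = eval_fls L (exp (2 * of_real pi * \<i> * z))) (filtercomap Im at_top)"
proof -
  obtain y where "\<forall>z. Im z > y \<longrightarrow> f z = eval_fls L (exp (2 * of_real pi * \<i> * z))"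
    using assms unfolding has_q_expansion_def by blast
  thus ?thesis unfolding eventually_filtercomap using eventually_gt_at_top[of y] by blast
qed

lemma has_q_expansion_laurent: "has_q_expansion f L \<Longrightarrow> eval_fls L has_laurent_expansion L"
  by (simp add: has_q_expansion_def eval_fls_has_laurent_expansion)

lemma has_q_expansion_tendsto:
  assumes "has_q_expansion f L" "fls_subdegree L \<ge> 0"
  shows "(f \<longlongrightarrow> fls_nth L 0) (filtercomap Im at_top)"
proof -
  have "eval_fls L \<midarrow>0\<rightarrow> fls_nth L 0"
    using has_laurent_expansion_imp_tendsto_0 has_q_expansion_laurent assms by blast
  from filterlim_compose[OF this nome_filterlim] show ?thesis
    by (rule tendsto_cong[OF has_q_expansion_eventually[OF assms(1)], THEN iffD2])
qed

lemma has_q_expansion_tendsto_inverse: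
  assumes "has_q_expansion f L" "fls_subdegree L < 0"
  shows "((\<lambda>z. inverse (f z)) \<longlongrightarrow> fls_nth (inverse L) 0) (filtercomap Im at_top)"
proof -
  have "(\<lambda>q. inverse (eval_fls L q)) has_laurent_expansion inverse L"
    by (intro has_laurent_expansion_inverse has_q_expansion_laurent[OF assms(1)])
  hence "(\<lambda>q. inverse (eval_fls L q)) \<midarrow>0\<rightarrow> fls_nth (inverse L) 0"
    by (rule has_laurent_expansion_imp_tendsto_0) (use assms in \<open>simp add: fls_inverse_subdegree\<close>)
  from filterlim_compose[OF this nome_filterlim] show ?thesis
  proof (rule tendsto_cong[THEN iffD2, rotated])
    show "\<forall>\<^sub>F z in filtercomap Im at_top.
        inverse (f z) = inverse (eval_fls L (exp (2 * complex_of_real pi * \<i> * z)))"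
      using has_q_expansion_eventually[OF assms(1)] by eventually_elim simp
  qed
qed

lemma mat_act_of_int:
  fixes a b c d :: int
  defines "g \<equiv> vector [vector [of_int a, of_int b], vector [of_int c, of_int d]] :: rat^2^2"
  shows "mat_act g z = (of_int a * z + of_int b) / (of_int c * z + of_int d)"
    and "a * d - b * c = 1 \<Longrightarrow> g \<in> SL2_Z"
proof -
  show "mat_act g z = (of_int a * z + of_int b) / (of_int c * z + of_int d)"
    by (simp add: mat_act_def g_def moebius_def)
  assume det: "a * d - b * c = 1"
  have "det g = of_int (a * d - b * c)" by (simp add: g_def det_2)
  thus "g \<in> SL2_Z" using det by (simp add: SL2_Z_def g_def forall_2)
qed

lemma modular_function_invariant:
  assumes "modular_function f" "z \<in> \<H>" "modular_equiv z w"
  shows "f w = f z"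
proof -
  obtain a b c d :: int where det: "a * d - b * c = 1"
    and w: "w = (of_int a * z + of_int b) / (of_int c * z + of_int d)"
    using assms(3) unfolding modular_equiv_def by blast
  show ?thesis using assms(1,2) mat_act_of_int(2)[OF det]
    unfolding w modular_function_def mat_act_of_int(1)[symmetric] by blast
qed

text \<open>By the identity theorem a meromorphic function on the connected \<open>\<H>\<close>
  either vanishes off a sparse set or is nonzero off one; the first case makes it constant.\<close>

lemma nonconstant_nonzero_near:
  assumes f: "modular_function f" and nc: "\<not> (\<exists>c. mero_eq f (\<lambda>_. c))" and z: "z \<in> \<H>"
  shows "eventually (\<lambda>w. f w \<noteq> 0) (at z)"
proof -
  have "f meromorphic_on \<H>" using f by (simp add: modular_function_def nicely_meromorphic_on_def)
  hence "(\<forall>\<^sub>\<approx>z\<in>\<H>. f z = 0) \<or> (\<forall>\<^sub>\<approx>z\<in>\<H>. f z \<noteq> 0)"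
    by (intro meromorphic_imp_constant_or_avoid open_upper_half_plane connected_upper_half_plane)
  hence "\<forall>\<^sub>\<approx>z\<in>\<H>. f z \<noteq> 0" using nc by (auto simp: mero_eq_def)
  thus ?thesis using z by (auto simp: eventually_cosparse_open_eq open_upper_half_plane)
qed

lemma modular_function_zero_iff:
  assumes f: "modular_function f" and nc: "\<not> (\<exists>c. mero_eq f (\<lambda>_. c))" and z: "z \<in> \<H>"
  shows "f z = 0 \<longleftrightarrow> isolated_zero f z \<or> is_pole f z"
proof
  have nm: "f nicely_meromorphic_on \<H>" using f by (simp add: modular_function_def)
  show "isolated_zero f z \<or> is_pole f z" if "f z = 0"
    using zero_or_pole[OF nm z that nonconstant_nonzero_near[OF f nc z]] .
  show "f z = 0" if "isolated_zero f z \<or> is_pole f z"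
    using that is_pole_zero_at_nicely_mero[OF nm _ z]
      zero_isolated_zero_nicely_meromorphic[OF _ nicely_meromorphic_on_subset[OF nm]] z by auto
qed

lemma modular_function_nonzero_analytic:
  assumes f: "modular_function f" and z: "z \<in> \<H>" "f z \<noteq> 0"
  shows "f analytic_on {z}"
proof -
  have nm: "f nicely_meromorphic_on \<H>" using f by (simp add: modular_function_def)
  moreover have "\<not> is_pole f z" using is_pole_zero_at_nicely_mero[OF nm _ z(1)] z(2) by blast
  ultimately show ?thesis using nicely_meromorphic_on_imp_analytic_at z(1) by blast
qed

text \<open>The value 0 also marks poles. If it never occurred, both \<open>f\<close> and its
  reciprocal would be holomorphic on \<open>\<H>\<close>, and whichever has a finite limit at the
  cusp would be constant.\<close>

lemma nonconstant_modular_function_has_zero: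
  assumes f: "modular_function f" and nc: "\<not> (\<exists>c. mero_eq f (\<lambda>_. c))"
  obtains z where "z \<in> \<H>" "f z = 0"
proof (rule ccontr)
  assume "\<not> thesis"
  hence nz: "f z \<noteq> 0" if "z \<in> \<H>" for z using that \<open>\<And>z. z \<in> \<H> \<Longrightarrow> f z = 0 \<Longrightarrow> thesis\<close> by blast
  have "f analytic_on \<H>"
    using modular_function_nonzero_analytic[OF f] nz by (subst analytic_on_analytic_at) blast
  hence holo: "f holomorphic_on \<H>" by (rule analytic_imp_holomorphic)
  obtain L where L: "has_q_expansion f L" using f by (auto simp: modular_function_def)
  have "\<exists>c. \<forall>z\<in>\<H>. f z = c"
  proof (cases "fls_subdegree L \<ge> 0")
    case True
    thus ?thesis
      using modular_invariant_holomorphic_constant[OF holo modular_function_invariant[OF f]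
          has_q_expansion_tendsto[OF L]] by blast
  next
    case False
    have "inverse (f z) = fls_nth (inverse L) 0" if "z \<in> \<H>" for z
    proof (rule modular_invariant_holomorphic_constant[OF _ _ _ that])
      show "(\<lambda>z. inverse (f z)) holomorphic_on \<H>" using holo nz by (intro holomorphic_intros) auto
      show "((\<lambda>z. inverse (f z)) \<longlongrightarrow> fls_nth (inverse L) 0) (filtercomap Im at_top)"
        using has_q_expansion_tendsto_inverse[OF L] False by simp
    qed (simp add: modular_function_invariant[OF f])
    thus ?thesis by (metis inverse_inverse_eq)
  qed
  then obtain c where "\<forall>z\<in>\<H>. f z = c" by blast
  hence "mero_eq f (\<lambda>_. c)" unfolding mero_eq_def
    by (intro eventually_mono[OF eventually_in_cosparse[OF order_refl open_upper_half_plane]]) blast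
  with nc show False by blast
qed

text \<open>The nonzero \<open>q\<close>-expansion excludes the value 0 near the cusp. What remains
  is a compact box, where a sparse set is finite.\<close>

lemma finite_zeros_fundamental_domain:
  assumes f: "modular_function f" and nc: "\<not> (\<exists>c. mero_eq f (\<lambda>_. c))"
  shows "finite {z. \<bar>Re z\<bar> \<le> 1/2 \<and> 1/2 \<le> Im z \<and> f z = 0}"
proof -
  obtain L where L: "has_q_expansion f L" using f by (auto simp: modular_function_def)
  have "L \<noteq> 0"
  proof
    assume "L = 0"
    then obtain y where y: "\<And>z. Im z > y \<Longrightarrow> f z = 0" using L by (auto simp: has_q_expansion_def)
    define z where "z = Complex 0 (max y 0 + 1)"
    have "z \<in> \<H>" by (simp add: z_def upper_half_plane_def)
    moreover have "eventually (\<lambda>w. w \<in> {w. Im w > y}) (at z)"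
      by (rule eventually_at_in_open') (auto simp: z_def open_halfspace_Im_gt)
    ultimately have "eventually (\<lambda>w. f w \<noteq> 0 \<and> w \<in> {w. Im w > y}) (at z)"
      using nonconstant_nonzero_near[OF f nc] by (intro eventually_conj)
    hence "eventually (\<lambda>w. False) (at z)" by (rule eventually_mono) (use y in auto)
    thus False by simp
  qed
  hence "eventually (\<lambda>q. eval_fls L q \<noteq> 0) (at 0)"
    using has_laurent_expansion_nonzero_imp_eventually_nonzero has_q_expansion_laurent[OF L] by blast
  hence "eventually (\<lambda>z. eval_fls L (exp (2 * of_real pi * \<i> * z)) \<noteq> 0) (filtercomap Im at_top)"
    using nome_filterlim by (rule eventually_compose_filterlim)
  with has_q_expansion_eventually[OF L] have "eventually (\<lambda>z. f z \<noteq> 0) (filtercomap Im at_top)"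
    by eventually_elim simp
  then obtain Y where Y: "\<And>z. Im z \<ge> Y \<Longrightarrow> f z \<noteq> 0"
    by (auto simp: eventually_filtercomap eventually_at_top_linorder)
  define K where "K = cbox (Complex (-1/2) (1/2)) (Complex (1/2) Y)"
  have KH: "K \<subseteq> \<H>" by (auto simp: K_def upper_half_plane_def in_cbox_complex_iff)
  have "eventually (\<lambda>z. f z \<noteq> 0) (cosparse \<H>)"
    using nonconstant_nonzero_near[OF f nc]
    by (simp add: eventually_cosparse_open_eq open_upper_half_plane)
  hence "{z. f z = 0} sparse_in \<H>" by (simp add: eventually_cosparse)
  hence "{z. f z = 0} sparse_in K" using KH by (rule sparse_in_subset)
  hence "finite (K \<inter> {z. f z = 0})" by (rule sparse_in_compact_finite) (simp add: K_def)
  moreover have "{z. \<bar>Re z\<bar> \<le> 1/2 \<and> 1/2 \<le> Im z \<and> f z = 0} \<subseteq> K \<inter> {z. f z = 0}"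
    using Y by (force simp: K_def in_cbox_complex_iff)
  ultimately show ?thesis by (rule finite_subset[rotated])
qed

section \<open>A zero or pole of maximal discriminant and its leading coefficient\<close>

lemma primitive_form_root_modular_equiv:
  assumes z: "z \<in> \<H>" and "modular_equiv z w" and "primitive_form_root z A B C"
  obtains A' B' C' where "primitive_form_root w A' B' C'" "4 * A' * C' - B'\<^sup>2 = 4 * A * C - B\<^sup>2"
proof -
  obtain a b c d :: int where det: "a * d - b * c = 1"
    and w: "w = (of_int a * z + of_int b) / (of_int c * z + of_int d)"
    using assms(2) unfolding modular_equiv_def by blast
  have wH: "w \<in> \<H>" using modular_equiv_upper_half_plane assms by blast
  have e: "of_int c * z + of_int d \<noteq> 0" using denom_nonzero[OF z, of c d] det by fastforce
  have e': "of_int (-c) * w + of_int a \<noteq> 0" using denom_nonzero[OF wH, of "-c" a] det by fastforce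
  have we: "w * (of_int c * z + of_int d) = of_int a * z + of_int b" using e w by simp
  \<comment> \<open>Forms transform by the inverse matrix, so \<open>z\<close> is expressed through
    \<open>w\<close>.\<close>
  have "z * (of_int (-c) * w + of_int a) = of_int d * w + of_int (-b)"
    using we by (simp add: algebra_simps)
  hence zeq: "z = (of_int d * w + of_int (-b)) / (of_int (-c) * w + of_int a)"
    using e' by (simp add: eq_divide_eq)
  have "d * a - (-b) * (-c) = 1" using det by (simp add: mult.commute)
  from that[OF primitive_form_root_moebius[OF assms(3) this e' zeq]] show thesis .
qed

text \<open>Every point with value 0 can be moved into the fundamental domain with the same
  discriminant, and only finitely many such points lie there, so a maximum exists.\<close>

lemma exists_zero_of_maximal_disc:
  assumes f: "modular_function f" and nc: "\<not> (\<exists>c. mero_eq f (\<lambda>_. c))"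
    and iq: "\<And>z. z \<in> \<H> \<Longrightarrow> f z = 0 \<Longrightarrow> imaginary_quadratic z"
  obtains s A B C where "s \<in> \<H>" "f s = 0" "primitive_form_root s A B C"
    "\<And>w D. w \<in> \<H> \<Longrightarrow> f w = 0 \<Longrightarrow> has_neg_disc w D \<Longrightarrow> D \<le> 4 * A * C - B\<^sup>2"
proof -
  define Z where "Z = {z. \<bar>Re z\<bar> \<le> 1/2 \<and> 1/2 \<le> Im z \<and> f z = 0}"
  have ZH: "z \<in> \<H>" if "z \<in> Z" for z using that by (simp add: Z_def upper_half_plane_def)
  define disc where "disc = (\<lambda>z. THE D. has_neg_disc z D)"
  have disc: "disc z = D" if "z \<in> \<H>" "has_neg_disc z D" for z D
    unfolding disc_def using that has_neg_disc_unique upper_half_plane_not_real by (blast intro: the_equality)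
  have move: "\<exists>w\<in>Z. has_neg_disc w D" if z: "z \<in> \<H>" "f z = 0" "has_neg_disc z D" for z D
  proof -
    obtain w where w: "modular_equiv z w" "\<bar>Re w\<bar> \<le> 1/2" "1/2 \<le> Im w"
      using modular_equiv_fundamental_domain[OF z(1)] by blast
    have "w \<in> Z" using w modular_function_invariant[OF f z(1) w(1)] z(2) by (simp add: Z_def)
    moreover have "has_neg_disc w D"
      using z(3) primitive_form_root_modular_equiv[OF z(1) w(1)] unfolding has_neg_disc_def by metis
    ultimately show ?thesis by blast
  qed
  have ex: "\<exists>D. has_neg_disc z D" if "z \<in> \<H>" "f z = 0" for z
    using imaginary_quadratic_primitive_form[OF iq[OF that]] unfolding has_neg_disc_def by metis
  have "finite (disc ` Z)" using finite_zeros_fundamental_domain[OF f nc] by (simp add: Z_def)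
  moreover have "disc ` Z \<noteq> {}"
    using nonconstant_modular_function_has_zero[OF f nc] ex move by (metis empty_iff image_is_empty)
  ultimately have "Max (disc ` Z) \<in> disc ` Z" by (rule Max_in)
  then obtain s where s: "s \<in> Z" "disc s = Max (disc ` Z)" by auto
  have fs: "s \<in> \<H>" "f s = 0" using s(1) ZH by (auto simp: Z_def)
  obtain D where D: "has_neg_disc s D" using ex[OF fs] by blast
  then obtain A B C where ABC: "primitive_form_root s A B C" "D = 4 * A * C - B\<^sup>2"
    unfolding has_neg_disc_def by blast
  show thesis
  proof (rule that[OF fs ABC(1)])
    fix w E assume w: "w \<in> \<H>" "f w = 0" "has_neg_disc w E"
    then obtain v where v: "v \<in> Z" "has_neg_disc v E" using move by blast
    have "E = disc v" using disc[OF ZH[OF v(1)] v(2)] by simp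
    also have "\<dots> \<le> Max (disc ` Z)" using v(1) \<open>finite (disc ` Z)\<close> by simp
    also have "\<dots> = D" using s(2) disc[OF fs(1) D] by simp
    finally show "E \<le> 4 * A * C - B\<^sup>2" using ABC by simp
  qed
qed

text \<open>A value taken at a coprime pair \<open>(x, y)\<close> is the leading coefficient of an
  equivalent form: take \<open>(x, y)\<close> as the first column of a unimodular
  substitution.\<close>

lemma modular_equiv_leading_coeff_coprime:
  assumes s: "s \<in> \<H>" and prim: "primitive_form_root s A B C" and M: "M \<noteq> 0"
  obtains s' A' B' C' where "modular_equiv s s'" "primitive_form_root s' A' B' C'"
    "4 * A' * C' - B'\<^sup>2 = 4 * A * C - B\<^sup>2" "coprime A' M"
proof -
  have "gcd A (gcd B C) = 1" using prim by (simp add: primitive_form_root_def)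
  from primitive_form_represents_coprime[OF this M] obtain x y
    where xy: "coprime x y" "coprime (A * x\<^sup>2 + B * x * y + C * y\<^sup>2) M" by blast
  obtain t r where "t * x + r * y = 1" using bezout_int[of x y] xy(1) by auto
  hence det: "x * t - (- r) * y = 1" by (simp add: mult.commute)
  define s' where "s' = (of_int t * s + of_int r) / (of_int (-y) * s + of_int x)"
  have equ: "modular_equiv s s'" unfolding modular_equiv_def s'_def
    using det by (intro exI[of _ t] exI[of _ r] exI[of _ "-y"] exI[of _ x]) (simp add: mult.commute)
  have sH: "s' \<in> \<H>" using modular_equiv_upper_half_plane[OF equ s] .
  have e: "of_int (-y) * s + of_int x \<noteq> 0" using denom_nonzero[OF s, of "-y" x] det by fastforce
  have e': "of_int y * s' + of_int t \<noteq> 0" using denom_nonzero[OF sH, of y t] det by fastforce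
  have "s' * (of_int (-y) * s + of_int x) = of_int t * s + of_int r" using e by (simp add: s'_def)
  hence "s * (of_int y * s' + of_int t) = of_int x * s' + of_int (-r)" by (simp add: algebra_simps)
  hence seq: "s = (of_int x * s' + of_int (-r)) / (of_int y * s' + of_int t)"
    using e' by (simp add: eq_divide_eq)
  show thesis
    using that[OF equ primitive_form_root_moebius[OF prim det e' seq] xy(2)] .
qed

section \<open>Rational affine maps and Hermite reduction\<close>

lemma rat_common_denominator:
  fixes x :: rat
  obtains N k where "N > 0" "of_int N * x = of_int k"
proof -
  obtain p q where pq: "quotient_of x = (p, q)" by (cases "quotient_of x")
  have "q > 0" using pq by (rule quotient_of_denom_pos)
  moreover have "of_int q * x = of_int p"
    unfolding quotient_of_div[OF pq] using \<open>q > 0\<close> by simp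
  ultimately show thesis by (rule that)
qed

text \<open>Brings the affine map with coefficients \<open>\<mu>\<close> and \<open>\<tau>\<close>
  into the shape \<open>(a z + b) / d\<close> without common factor, as
  \<open>neg_disc_affine_less\<close> requires.\<close>

lemma rat_pair_lowest_terms:
  fixes \<mu> \<tau> :: rat
  obtains a b d :: int where "d > 0" "\<mu> = of_int a / of_int d" "\<tau> = of_int b / of_int d"
    "gcd d (gcd a b) = 1"
proof -
  obtain N k N' k' where N: "N > 0" "of_int N * \<mu> = of_int k" "N' > 0" "of_int N' * \<tau> = of_int k'"
    using rat_common_denominator by metis
  have "N * N' \<noteq> 0" using N by simp
  then obtain g d a b where g: "g > 0" "N * N' = g * d" "N' * k = g * a" "N * k' = g * b"
    and gcd1: "gcd d (gcd a b) = 1"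
    by (rule int_triple_primitive_part)
  have "g * d > 0" using N by (simp flip: g(2))
  hence d: "d > 0" using g(1) by (simp add: zero_less_mult_iff)
  have "of_int (g * d) * \<mu> = of_int N' * (of_int N * \<mu>)" by (simp flip: g(2))
  also have "\<dots> = of_int (g * a)" unfolding N by (simp flip: g(3))
  finally have 1: "\<mu> = of_int a / of_int d" using g(1) d by (simp add: field_simps)
  have "of_int (g * d) * \<tau> = of_int N * (of_int N' * \<tau>)" by (simp flip: g(2))
  also have "\<dots> = of_int (g * b)" unfolding N by (simp flip: g(4))
  finally have 2: "\<tau> = of_int b / of_int d" using g(1) d by (simp add: field_simps)
  show thesis by (rule that[OF d 1 2 gcd1])
qed

lemma affine_in_upper_half_plane:
  assumes "\<nu> > 0" "z \<in> \<H>"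
  shows "of_rat \<nu> * z + of_rat \<beta> \<in> \<H>"
proof -
  have c: "(of_rat x :: complex) = of_real (of_rat x)" for x by (cases x) (simp add: of_rat_rat)
  show ?thesis using assms by (simp add: upper_half_plane_def c)
qed

text \<open>A scaled integral matrix factors as a unimodular matrix times an upper triangular one.
  The left factor disappears by invariance of \<open>f\<close>, and the triangular one acts
  affinely.\<close>

lemma GL2_Q_pos_act_affine:
  assumes f: "modular_function f" and g: "g \<in> GL2_Q_pos"
  obtains \<nu> \<beta> :: rat where "\<nu> > 0"
    "\<And>z. z \<in> \<H> \<Longrightarrow> f (mat_act g z) = f (of_rat \<nu> * z + of_rat \<beta>)"
proof -
  define p where "p = g $ 1 $ 1"
  define q where "q = g $ 1 $ 2"
  define r where "r = g $ 2 $ 1"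
  define s where "s = g $ 2 $ 2"
  have det: "p * s - q * r > 0" using g by (simp add: GL2_Q_pos_def det_2 p_def q_def r_def s_def)
  obtain n1 k1 n2 k2 n3 k3 n4 k4 where
    n: "n1 > 0" "of_int n1 * p = of_int k1" "n2 > 0" "of_int n2 * q = of_int k2"
       "n3 > 0" "of_int n3 * r = of_int k3" "n4 > 0" "of_int n4 * s = of_int k4"
    using rat_common_denominator by metis
  define N where "N = n1 * n2 * n3 * n4"
  have N: "N > 0" using n by (simp add: N_def)
  define P where "P = k1 * n2 * n3 * n4"
  define Q where "Q = n1 * k2 * n3 * n4"
  define R where "R = n1 * n2 * k3 * n4"
  define S where "S = n1 * n2 * n3 * k4"
  have ent: "of_int P = of_int N * p" "of_int Q = of_int N * q"
            "of_int R = of_int N * r" "of_int S = of_int N * s"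
    by (simp_all add: P_def Q_def R_def S_def N_def mult_ac flip: n(2,4,6,8))
  have "of_int (P * S - Q * R) = (of_int N)\<^sup>2 * (p * s - q * r)"
    by (simp add: ent power2_eq_square algebra_simps)
  also have "\<dots> > 0" using N det by simp
  finally have det': "P * S - Q * R > 0" by (simp only: of_int_0_less_iff)
  have act: "mat_act g z = (of_int P * z + of_int Q) / (of_int R * z + of_int S)" for z
  proof -
    have c: "(of_int P :: complex) = of_int N * of_rat p" "(of_int Q :: complex) = of_int N * of_rat q"
         "(of_int R :: complex) = of_int N * of_rat r" "(of_int S :: complex) = of_int N * of_rat s"
      using ent by (metis of_rat_mult of_rat_of_int_eq)+
    have "(of_int P * z + of_int Q) / (of_int R * z + of_int S) =
      (of_int N * (of_rat p * z + of_rat q)) / (of_int N * (of_rat r * z + of_rat s))"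
      by (simp add: c algebra_simps)
    also have "\<dots> = (of_rat p * z + of_rat q) / (of_rat r * z + of_rat s)" using N by simp
    finally show ?thesis by (simp add: mat_act_def moebius_def p_def q_def r_def s_def)
  qed
  define h where "h = gcd P R"
  have "P \<noteq> 0 \<or> R \<noteq> 0" using det' by auto
  hence h: "h > 0" by (auto simp: h_def)
  obtain P' R' where PR: "P = h * P'" "R = h * R'"
    unfolding h_def by (meson dvdE gcd_dvd1 gcd_dvd2)
  obtain u v where "u * P + v * R = h" unfolding h_def using bezout_int by blast
  hence "h * (u * P' + v * R') = h * 1" by (simp add: PR algebra_simps)
  hence uv: "u * P' + v * R' = 1" using h by simp
  \<comment> \<open>The factorisation has left factor with rows \<open>(P', -v)\<close> and
    \<open>(R', u)\<close>, of determinant 1, and right factor with rows \<open>(h, k)\<close> and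
    \<open>(0, e)\<close>.\<close>
  define e where "e = P' * S - R' * Q"
  define k where "k = u * Q + v * S"
  have "h * e > 0" using det' by (simp add: e_def PR algebra_simps)
  hence e: "e > 0" using h by (simp add: zero_less_mult_iff)
  have ke: "P' * k - v * e = Q" "R' * k + u * e = S"
  proof -
    have "P' * k - v * e = (u * P' + v * R') * Q" by (simp add: k_def e_def algebra_simps)
    thus "P' * k - v * e = Q" by (simp add: uv)
    have "R' * k + u * e = (u * P' + v * R') * S" by (simp add: k_def e_def algebra_simps)
    thus "R' * k + u * e = S" by (simp add: uv)
  qed
  define \<nu> where "\<nu> = (of_int h / of_int e :: rat)"
  define \<beta> where "\<beta> = (of_int k / of_int e :: rat)"
  have nu: "\<nu> > 0" using h e by (simp add: \<nu>_def)
  have "f (mat_act g z) = f (of_rat \<nu> * z + of_rat \<beta>)" if z: "z \<in> \<H>" for z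
  proof (rule modular_function_invariant[OF f affine_in_upper_half_plane[OF nu z]])
    define w where "w = of_rat \<nu> * z + of_rat \<beta>"
    have ew: "of_int e * w = of_int h * z + of_int k"
      using e by (simp add: w_def \<nu>_def \<beta>_def of_rat_divide field_simps)
    have num: "of_int P * z + of_int Q = of_int e * (of_int P' * w + of_int (-v))"
    proof -
      have "of_int e * (of_int P' * w + of_int (-v)) = of_int P' * (of_int e * w) - of_int (v * e)"
        by (simp add: algebra_simps)
      also have "\<dots> = of_int (h * P') * z + of_int (P' * k - v * e)"
        unfolding ew by (simp add: algebra_simps)
      finally show ?thesis by (simp add: ke PR)
    qed
    have den: "of_int R * z + of_int S = of_int e * (of_int R' * w + of_int u)"
    proof -
      have "of_int e * (of_int R' * w + of_int u) = of_int R' * (of_int e * w) + of_int (u * e)"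
        by (simp add: algebra_simps)
      also have "\<dots> = of_int (h * R') * z + of_int (R' * k + u * e)"
        unfolding ew by (simp add: algebra_simps)
      finally show ?thesis by (simp add: ke PR)
    qed
    have "mat_act g z = (of_int P' * w + of_int (-v)) / (of_int R' * w + of_int u)"
      unfolding act num den using e by simp
    moreover have "P' * u - (-v) * R' = 1" using uv by (simp add: mult.commute)
    ultimately show "modular_equiv (of_rat \<nu> * z + of_rat \<beta>) (mat_act g z)"
      unfolding modular_equiv_def w_def[symmetric] by blast
  qed
  with nu show thesis by (rule that)
qed

section \<open>Integer powers near zeros and poles\<close>

lemma isolated_zero_powi_not_tendsto:
  fixes f :: "complex \<Rightarrow> complex"
  assumes "isolated_zero f s" "k \<noteq> 0" "L \<noteq> 0"
  shows "\<not> ((\<lambda>z. f z powi k) \<longlongrightarrow> L) (at s)"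
proof
  assume lim: "((\<lambda>z. f z powi k) \<longlongrightarrow> L) (at s)"
  have f0: "(f \<longlongrightarrow> 0) (at s)" using assms(1) by (simp add: isolated_zero_def)
  show False
  proof (cases "k > 0")
    case True
    hence "((\<lambda>z. f z powi k) \<longlongrightarrow> 0) (at s)"
      using tendsto_power[OF f0, of "nat k"] by (simp add: power_int_def zero_power)
    from LIM_unique[OF this lim] assms(3) show False by simp
  next
    case False
    with assms(2) have k: "k < 0" by simp
    have "((\<lambda>z. inverse (f z powi k)) \<longlongrightarrow> 0) (at s)"
      unfolding power_int_minus[symmetric]
      using k tendsto_power[OF f0, of "nat (-k)"] by (simp add: power_int_def zero_power)
    moreover have "((\<lambda>z. inverse (f z powi k)) \<longlongrightarrow> inverse L) (at s)"
      by (intro tendsto_inverse lim assms)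
    ultimately have "inverse L = 0"
      by (intro LIM_unique)
    with assms(3) show False by simp
  qed
qed

text \<open>Passing to the reciprocal turns a pole into a zero and changes the sign of the
  exponent.\<close>

lemma zero_or_pole_powi_not_tendsto:
  fixes f :: "complex \<Rightarrow> complex"
  assumes "isolated_zero f s \<or> is_pole f s" "k \<noteq> 0" "L \<noteq> 0"
  shows "\<not> ((\<lambda>z. f z powi k) \<longlongrightarrow> L) (at s)"
  using assms(1)
proof
  assume "is_pole f s"
  hence "isolated_zero (\<lambda>z. inverse (f z)) s" by (simp add: isolated_zero_inverse_iff)
  hence "\<not> ((\<lambda>z. inverse (f z) powi (-k)) \<longlongrightarrow> L) (at s)"
    by (rule isolated_zero_powi_not_tendsto) (use assms in auto)
  thus ?thesis by (simp add: power_int_minus power_int_inverse)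
qed (use isolated_zero_powi_not_tendsto assms in blast)

subsection \<open>Multiplicative independence\<close>

theorem theorem3p2:
  fixes f :: "complex \<Rightarrow> complex" and n :: nat and g :: "nat \<Rightarrow> rat^2^2"
  assumes "f \<in> B0"
    and "\<not> (\<exists>c. mero_eq f (\<lambda>_. c))"
    and "\<And>i. i \<in> {1..n} \<Longrightarrow> g i \<in> GL2_Q_pos"
    and "\<And>i j. i \<in> {1..n} \<Longrightarrow> j \<in> {1..n} \<Longrightarrow> i \<noteq> j \<Longrightarrow>
           \<not> mero_eq (\<lambda>z. f (mat_act (g i) z)) (\<lambda>z. f (mat_act (g j) z))"
  shows "mult_indep_mod_const n (\<lambda>i z. f (mat_act (g i) z))"
  unfolding mult_indep_mod_const_def
proof (rule notI, elim exE conjE)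
  fix a :: "nat \<Rightarrow> int" and c :: complex
  assume a: "\<exists>i\<in>{1..n}. a i \<noteq> 0"
    and rel: "mero_eq (\<lambda>z. \<Prod>i\<in>{1..n}. f (mat_act (g i) z) powi a i) (\<lambda>_. c)"
  note nc = assms(2)
  have f: "modular_function f" using assms(1) by (simp add: B0_def)
  have iq: "imaginary_quadratic z" if "z \<in> \<H>" "f z = 0" for z
    using that assms(1) modular_function_zero_iff[OF f nc that(1)] unfolding B0_def by blast
  have "\<exists>\<nu> \<beta>. \<nu> > 0 \<and> (\<forall>z\<in>\<H>. f (mat_act (g i) z) = f (of_rat \<nu> * z + of_rat \<beta>))"
    if "i \<in> {1..n}" for i
    using GL2_Q_pos_act_affine[OF f assms(3)[OF that]] by metis
  then obtain \<nu> \<beta> where \<nu>: "\<And>i. i \<in> {1..n} \<Longrightarrow> \<nu> i > 0"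
    and act: "\<And>i z. i \<in> {1..n} \<Longrightarrow> z \<in> \<H> \<Longrightarrow>
                f (mat_act (g i) z) = f (of_rat (\<nu> i) * z + of_rat (\<beta> i))"
    by metis
  \<comment> \<open>Only indices that really occur in the relation may compete for the minimal
    \<open>\<nu>\<close>.\<close>
  define I where "I = {i \<in> {1..n}. a i \<noteq> 0}"
  have I: "finite I" "I \<noteq> {}" "\<And>i. i \<in> I \<Longrightarrow> i \<in> {1..n} \<and> a i \<noteq> 0" using a by (auto simp: I_def)
  obtain i0 where i0: "i0 \<in> I" "\<And>i. i \<in> I \<Longrightarrow> \<nu> i0 \<le> \<nu> i"
    by (metis I(1,2) arg_min_if_finite(1) arg_min_least)
  \<comment> \<open>Coefficients of the \<open>i\<close>-th affine map in terms of the
    \<open>i0\<close>-th: if \<open>w = \<nu> i0 * z + \<beta> i0\<close>, then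
    \<open>\<nu> i * z + \<beta> i = \<mu> i * w + \<tau> i\<close>.\<close>
  define \<mu> where "\<mu> = (\<lambda>i. \<nu> i / \<nu> i0)"
  define \<tau> where "\<tau> = (\<lambda>i. \<beta> i - \<mu> i * \<beta> i0)"
  have \<nu>0: "\<nu> i0 > 0" using i0(1) I(3) \<nu> by blast
  have \<mu>1: "\<mu> i \<ge> 1" if "i \<in> I" for i using i0(2)[OF that] \<nu>0 by (simp add: \<mu>_def)
  have \<mu>i0: "\<mu> i0 = 1" "\<tau> i0 = 0" using \<nu>0 by (auto simp: \<mu>_def \<tau>_def)
  define J where "J = I - {i0}"
  \<comment> \<open>An integral translation is absorbed by the invariance of \<open>f\<close>, so
    two of the given functions would coincide.\<close>
  have ntriv: "\<not> (\<mu> i = 1 \<and> \<tau> i = of_int m)" if i: "i \<in> J" for i m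
  proof
    assume "\<mu> i = 1 \<and> \<tau> i = of_int m"
    hence eq: "\<nu> i = \<nu> i0" "\<beta> i = \<beta> i0 + of_int m" using \<nu>0 by (auto simp: \<mu>_def \<tau>_def)
    have ii: "i \<in> {1..n}" "i0 \<in> {1..n}" "i \<noteq> i0" using i i0(1) I(3) by (auto simp: J_def)
    have "f (mat_act (g i) z) = f (mat_act (g i0) z)" if z: "z \<in> \<H>" for z
    proof -
      let ?w = "of_rat (\<nu> i0) * z + of_rat (\<beta> i0)"
      have "modular_equiv ?w (?w + of_int m)" unfolding modular_equiv_def
        by (intro exI[of _ 1] exI[of _ m] exI[of _ 0]) simp
      hence "f (?w + of_int m) = f ?w"
        by (intro modular_function_invariant[OF f affine_in_upper_half_plane[OF \<nu>0 z]])
      thus ?thesis using act[OF ii(1) z] act[OF ii(2) z] by (simp add: eq of_rat_add add.assoc)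
    qed
    hence "mero_eq (\<lambda>z. f (mat_act (g i) z)) (\<lambda>z. f (mat_act (g i0) z))" unfolding mero_eq_def
      by (intro eventually_mono[OF eventually_in_cosparse[OF order_refl open_upper_half_plane]]) blast
    with assms(4)[OF ii] show False by blast
  qed
  have "\<exists>p q r :: int. r > 0 \<and> \<mu> i = of_int p / of_int r \<and> \<tau> i = of_int q / of_int r \<and>
          gcd r (gcd p q) = 1" for i
    using rat_pair_lowest_terms by metis
  then obtain p q r where r: "\<And>i. r i > (0 :: int)" and pqr: "\<And>i. \<mu> i = of_int (p i) / of_int (r i)"
      "\<And>i. \<tau> i = of_int (q i) / of_int (r i)" "\<And>i. gcd (r i) (gcd (p i) (q i)) = 1"
    by metis
  have rp: "r i \<le> p i" if "i \<in> I" for i using \<mu>1[OF that] r[of i] by (simp add: pqr)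
  have pr0: "p i * r i \<noteq> 0" if "i \<in> I" for i using rp[OF that] r[of i] by auto
  define M where "M = (\<Prod>i\<in>J. p i * r i)"
  have M: "M \<noteq> 0" using I(1) pr0 by (simp add: M_def J_def)
  obtain s0 A0 B0 C0 where s0: "s0 \<in> \<H>" "f s0 = 0" "primitive_form_root s0 A0 B0 C0"
    and max0: "\<And>w D. w \<in> \<H> \<Longrightarrow> f w = 0 \<Longrightarrow> has_neg_disc w D \<Longrightarrow> D \<le> 4 * A0 * C0 - B0\<^sup>2"
    using exists_zero_of_maximal_disc[OF f nc iq] by blast
  obtain s A B C where s: "modular_equiv s0 s" and prim: "primitive_form_root s A B C"
    and D: "4 * A * C - B\<^sup>2 = 4 * A0 * C0 - B0\<^sup>2" and cop: "coprime A M"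
    using modular_equiv_leading_coeff_coprime[OF s0(1,3) M] by blast
  have sH: "s \<in> \<H>" using modular_equiv_upper_half_plane[OF s s0(1)] .
  have fs: "f s = 0" using modular_function_invariant[OF f s0(1) s] s0(2) by simp
  define w where "w = (\<lambda>i z. of_rat (\<mu> i) * z + of_rat (\<tau> i) :: complex)"
  have wH: "w i z \<in> \<H>" if "i \<in> I" "z \<in> \<H>" for i z
    unfolding w_def using affine_in_upper_half_plane[OF less_le_trans[OF zero_less_one \<mu>1[OF that(1)]] that(2)] .
  have wi0: "w i0 z = z" for z by (simp add: w_def \<mu>i0)
  \<comment> \<open>A value 0 would make \<open>w i s\<close> imaginary quadratic with discriminant
    exceeding the maximum attained at \<open>s\<close>.\<close>
  have fw: "f (w i s) \<noteq> 0" if i: "i \<in> J" for i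
  proof
    assume 0: "f (w i s) = 0"
    have iI: "i \<in> I" using i by (simp add: J_def)
    obtain D' where D': "has_neg_disc (w i s) D'"
      using imaginary_quadratic_primitive_form[OF iq[OF wH[OF iI sH] 0]] unfolding has_neg_disc_def by metis
    have "w i s = (of_int (p i) * s + of_int (q i)) / of_int (r i)"
      using r[of i] by (simp add: w_def pqr of_rat_divide field_simps)
    moreover have "coprime A (p i * r i)"
    proof -
      have "p i * r i dvd M" unfolding M_def using i I(1) by (intro dvd_prodI) (auto simp: J_def)
      thus ?thesis using cop by (rule coprime_divisors[OF dvd_refl])
    qed
    moreover have "p i \<noteq> 1 \<or> r i \<noteq> 1" using ntriv[OF i, of "q i"] by (auto simp: pqr)
    ultimately have "4 * A * C - B\<^sup>2 < D'"
      using neg_disc_affine_less[OF upper_half_plane_not_real[OF sH] prim _ r[of i] rp[OF iI] pqr(3)] D'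
      by simp
    with max0[OF wH[OF iI sH] 0 D'] D show False by simp
  qed
  \<comment> \<open>The inverse of the \<open>i0\<close>-th affine map. Substituting it moves the
    relation to a neighbourhood of \<open>s\<close>, where the \<open>i0\<close>-th factor becomes a
    power of \<open>f\<close> itself.\<close>
  define \<phi> where "\<phi> = (\<lambda>z. (z - of_rat (\<beta> i0)) / of_rat (\<nu> i0) :: complex)"
  have \<phi>: "of_rat (\<nu> i) * \<phi> z + of_rat (\<beta> i) = w i z" for i z
    using \<nu>0 by (simp add: \<phi>_def w_def \<tau>_def \<mu>_def of_rat_divide of_rat_diff of_rat_mult field_simps)
  have \<phi>H: "\<phi> z \<in> \<H>" if "z \<in> \<H>" for z
    using affine_in_upper_half_plane[of "1 / \<nu> i0" z "- \<beta> i0 / \<nu> i0"] \<nu>0 that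
    by (simp add: \<phi>_def of_rat_divide of_rat_minus diff_divide_distrib)
  have "\<forall>\<^sub>F z in at (\<phi> s). (\<Prod>i\<in>{1..n}. f (mat_act (g i) z) powi a i) = c"
    using rel \<phi>H[OF sH] by (simp add: mero_eq_def eventually_cosparse_open_eq open_upper_half_plane)
  moreover have "filterlim \<phi> (at (\<phi> s)) (at s)"
  proof (rule filterlim_atI)
    show "(\<phi> \<longlongrightarrow> \<phi> s) (at s)" unfolding \<phi>_def using \<nu>0 by (intro tendsto_intros) auto
    show "\<forall>\<^sub>F z in at s. \<phi> z \<noteq> \<phi> s"
      using eventually_neq_at_within[of s s UNIV] by eventually_elim (use \<nu>0 in \<open>simp add: \<phi>_def\<close>)
  qed
  ultimately have "\<forall>\<^sub>F z in at s. (\<Prod>i\<in>{1..n}. f (mat_act (g i) (\<phi> z)) powi a i) = c"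
    by (rule eventually_compose_filterlim)
  moreover have "\<forall>\<^sub>F z in at s. z \<in> \<H>"
    by (rule eventually_at_in_open'[OF open_upper_half_plane sH])
  ultimately have relw: "\<forall>\<^sub>F z in at s. f z powi a i0 * (\<Prod>i\<in>J. f (w i z) powi a i) = c"
  proof eventually_elim
    case (elim z)
    have "c = (\<Prod>i\<in>{1..n}. f (w i z) powi a i)"
      unfolding elim(1)[symmetric] using act \<phi>H[OF elim(2)] by (intro prod.cong) (simp_all add: \<phi>)
    also have "\<dots> = (\<Prod>i\<in>I. f (w i z) powi a i)"
      by (intro prod.mono_neutral_right) (auto simp: I_def)
    also have "\<dots> = f (w i0 z) powi a i0 * (\<Prod>i\<in>J. f (w i z) powi a i)"
      unfolding J_def using I(1) i0(1) by (rule prod.remove)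
    finally show ?case by (simp add: wi0)
  qed
  define P where "P = (\<Prod>i\<in>J. f (w i s) powi a i)"
  have P0: "P \<noteq> 0" using fw I(1) by (simp add: P_def J_def)
  have lim: "((\<lambda>z. \<Prod>i\<in>J. f (w i z) powi a i) \<longlongrightarrow> P) (at s)" unfolding P_def
  proof (intro tendsto_prod tendsto_power_int)
    fix i assume i: "i \<in> J"
    show "f (w i s) \<noteq> 0" by (rule fw[OF i])
    have "isCont f (w i s)"
      using modular_function_nonzero_analytic[OF f wH fw[OF i]] i sH
      by (auto simp: J_def intro: analytic_at_imp_isCont)
    moreover have "((\<lambda>z. w i z) \<longlongrightarrow> w i s) (at s)" unfolding w_def by (intro tendsto_intros)
    ultimately show "((\<lambda>z. f (w i z)) \<longlongrightarrow> f (w i s)) (at s)" by (rule isCont_tendsto_compose)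
  qed
  have Pnz: "\<forall>\<^sub>F z in at s. (\<Prod>i\<in>J. f (w i z) powi a i) \<noteq> 0"
    using tendsto_imp_eventually_ne[OF lim P0] .
  \<comment> \<open>Near \<open>s\<close> all factors of the product are nonzero. The limit
    \<open>c / P\<close> below is then nonzero, which a nontrivial power of \<open>f\<close> cannot
    have at a zero or pole.\<close>
  have c0: "c \<noteq> 0"
  proof
    assume "c = 0"
    have "\<forall>\<^sub>F z in at s. False"
      using relw Pnz nonconstant_nonzero_near[OF f nc sH] by eventually_elim (simp add: \<open>c = 0\<close>)
    thus False by simp
  qed
  have "((\<lambda>z. c / (\<Prod>i\<in>J. f (w i z) powi a i)) \<longlongrightarrow> c / P) (at s)" using lim P0 by (intro tendsto_intros)
  moreover have "\<forall>\<^sub>F z in at s. c / (\<Prod>i\<in>J. f (w i z) powi a i) = f z powi a i0"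
    using relw Pnz by eventually_elim (simp add: field_simps)
  ultimately have "((\<lambda>z. f z powi a i0) \<longlongrightarrow> c / P) (at s)"
    by (rule Lim_transform_eventually)
  moreover have "isolated_zero f s \<or> is_pole f s" using modular_function_zero_iff[OF f nc sH] fs by simp
  ultimately show False
    using zero_or_pole_powi_not_tendsto[of f s "a i0" "c / P"] c0 P0 I(3)[OF i0(1)] by simp
qed

end
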